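(* Let $n\ge 1$, $1\le i\le n$ and $k\ge 1$ be integers, with the convention $\binom{a}{b}=0$ if $b<0$ or $b>a$. For $1\le r,s\le n$ put \[ b^{(1)}_{r,s}=\frac{1}{2^{r-1}}\binom{r-1}{s-1},\qquad b^{(2)}_{r,s}=\frac{1}{2^{n-r}}\binom{n-r}{s-r}. \] For a list $L=[L[1],\dots,L[k]]$ with entries in $\{1,2\}$ define \[ p_L(j)=\sum_{s_1=1}^n\cdots\sum_{s_{k-1}=1}^n b^{(L[1])}_{i,s_1}b^{(L[2])}_{s_1,s_2}\cdots b^{(L[k])}_{s_{k-1},j},\qquad j=1,\dots,n \] (for $k=1$ this is $p_L(j)=b^{(L[1])}_{i,j}$), and its generating function $F_L(x)=\sum_{j=1}^n p_L(j)\,x^j$. Index the $2^k$ lists as $L_1,\dots,L_{2^k}$, where $L_t$ is the unique list with $t=1+\sum_{m=1}^{k}(L_t[m]-1)\,2^{m-1}$. Let \[ g(a,b)=[ax+(1-a)]^{n-i}\,[bx+(1-b)]^{i-1}\,x. \] Then for every $t=1,2,\dots,2^k$, \[ F_{L_t}(x)=g\!\left(\frac{t-1}{2^k},\frac{t}{2^k}\right). \]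
   Context: This arises from riffle shuffling a deck of $n$ cards: the one-shuffle probability that position $i$ holds card $j$ is $a(i,j,n)=\frac12\big(b^{(1)}_{i,j}+b^{(2)}_{i,j}\big)$, and the $k$-shuffle probability $a^{(k)}_{i,j}$ (entries of the $k$-th power of the matrix $(a(i,j,n))_{i,j}$) equals $2^{-k}\sum_{L}p_L(j)$. The indexing of lists by $t$ is the one obtained by repeatedly prepending an entry: if $L'$ has index $t'$ among lists of length $k-1$, then $[1,L']$ has index $2t'-1$ and $[2,L']$ has index $2t'$. *)

theory Defs
  imports Complex_Main "HOL-Computational_Algebra.Polynomial" "HOL-Library.FuncSet"
begin

text \<open>
  The lower argument may be negative (as for \<open>s - r\<close> below), so the arguments are integers:
  truncated subtraction on \<open>nat\<close> would give \<open>(n - r) choose 0 = 1\<close> there.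
\<close>

definition binom :: "int \<Rightarrow> int \<Rightarrow> nat" where
  "binom a b = (if b < 0 \<or> b > a then 0 else nat a choose nat b)"

definition b1 :: "nat \<Rightarrow> nat \<Rightarrow> real" where
  "b1 r s = 1 / 2 ^ (r - 1) * real (binom (int r - 1) (int s - 1))"

definition b2 :: "nat \<Rightarrow> nat \<Rightarrow> nat \<Rightarrow> real" where
  "b2 n r s = 1 / 2 ^ (n - r) * real (binom (int n - int r) (int s - int r))"

definition bmat :: "nat \<Rightarrow> nat \<Rightarrow> nat \<Rightarrow> nat \<Rightarrow> real" where
  "bmat n l r s = (if l = 1 then b1 r s else b2 n r s)"

text \<open>
  \<open>path k i j s\<close> is the sequence \<open>i, s 1, \<dots>, s (k - 1), j\<close>, indexed by \<open>0, \<dots>, k\<close>.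
\<close>

definition path :: "nat \<Rightarrow> nat \<Rightarrow> nat \<Rightarrow> (nat \<Rightarrow> nat) \<Rightarrow> nat \<Rightarrow> nat" where
  "path k i j s m = (if m = 0 then i else if m = k then j else s m)"

text \<open>
  The iterated sum over \<open>s\<^sub>1, \<dots>, s\<^sub>k\<^sub>-\<^sub>1\<close> is a single sum over all maps from
  \<open>{1..k - 1}\<close> to \<open>{1..n}\<close>. The 1-based entry \<open>L[m]\<close> is \<open>L ! (m - 1)\<close>.
\<close>

definition pL :: "nat \<Rightarrow> nat \<Rightarrow> nat list \<Rightarrow> nat \<Rightarrow> real" where
  "pL n i L j =
     (\<Sum>s \<in> {1..length L - 1} \<rightarrow>\<^sub>E {1..n}.
        \<Prod>m = 1..length L.
          bmat n (L ! (m - 1)) (path (length L) i j s (m - 1)) (path (length L) i j s m))"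

definition FL :: "nat \<Rightarrow> nat \<Rightarrow> nat list \<Rightarrow> real poly" where
  "FL n i L = (\<Sum>j = 1..n. monom (pL n i L j) j)"

definition has_index :: "nat \<Rightarrow> nat list \<Rightarrow> nat \<Rightarrow> bool" where
  "has_index k L t \<longleftrightarrow>
     length L = k \<and> set L \<subseteq> {1, 2} \<and> t = 1 + (\<Sum>m = 1..k. (L ! (m - 1) - 1) * 2 ^ (m - 1))"

definition list_of_index :: "nat \<Rightarrow> nat \<Rightarrow> nat list" where
  "list_of_index k t = (THE L. has_index k L t)"

definition g :: "nat \<Rightarrow> nat \<Rightarrow> real \<Rightarrow> real \<Rightarrow> real poly" where
  "g n i a b = [:1 - a, a:] ^ (n - i) * [:1 - b, b:] ^ (i - 1) * [:0, 1:]"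

lemma has_index_Cons:
  "has_index (Suc k) (l # L) t \<longleftrightarrow> l \<in> {1, 2} \<and> (\<exists>t'. has_index k L t' \<and> t + 2 = 2 * t' + l)"
proof -
  have "(\<Sum>m = 1..Suc k. ((l # L) ! (m - 1) - 1) * 2 ^ (m - 1))
      = (l - 1) + 2 * (\<Sum>m = 1..k. (L ! (m - 1) - 1) * 2 ^ (m - 1))"
  proof -
    have "(\<Sum>m = 1..Suc k. ((l # L) ! (m - 1) - 1) * 2 ^ (m - 1))
        = (\<Sum>m<Suc k. ((l # L) ! m - 1) * 2 ^ m)"
      by (rule sum.reindex_bij_witness[of _ Suc "\<lambda>m. m - 1"]) auto
    also have "\<dots> = (l - 1) + 2 * (\<Sum>m<k. (L ! m - 1) * 2 ^ m)"
      by (subst sum.lessThan_Suc_shift) (simp add: sum_distrib_left mult_ac)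
    also have "(\<Sum>m<k. (L ! m - 1) * 2 ^ m) = (\<Sum>m = 1..k. (L ! (m - 1) - 1) * 2 ^ (m - 1))"
      by (rule sum.reindex_bij_witness[of _ "\<lambda>m. m - 1" Suc]) auto
    finally show ?thesis .
  qed
  then show ?thesis
    unfolding has_index_def by auto
qed

lemma has_index_ex1:
  assumes "t \<in> {1..2 ^ k}"
  shows "\<exists>!L. has_index k L t"
  using assms
proof (induction k arbitrary: t)
  case 0
  then show ?case by (auto simp: has_index_def)
next
  case (Suc k)
  define t' l where "t' = (t + 1) div 2" and "l = (if odd t then 1 else 2 :: nat)"
  have tl: "t + 2 = 2 * t' + l" "l \<in> {1, 2}"
    by (auto simp: t'_def l_def elim!: oddE evenE)
  have "t' \<in> {1..2 ^ k}"
    using Suc.prems by (auto simp: t'_def)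
  from Suc.IH[OF this] obtain L where
    L: "has_index k L t'" and uniq: "\<And>M. has_index k M t' \<Longrightarrow> M = L" by blast
  show ?case
  proof (rule ex1I[of _ "l # L"])
    show "has_index (Suc k) (l # L) t"
      using L tl by (auto simp: has_index_Cons)
  next
    fix M assume M: "has_index (Suc k) M t"
    then obtain m N where MN: "M = m # N"
      by (cases M) (auto simp: has_index_def)
    with M obtain u where u: "m \<in> {1, 2}" "has_index k N u" "t + 2 = 2 * u + m"
      by (auto simp: has_index_Cons)
    have "u = t' \<and> m = l"
      using u(1,3) tl by auto presburger+
    with u(2) uniq MN show "M = l # L" by blast
  qed
qed

end

theory Submission
  imports Defs
begin

text \<open>
  Prepending an entry \<open>l\<close> to a list averages the generating functions \<open>FL n r L\<close> over the
  start \<open>r\<close>, with weights \<open>bmat n l i r\<close>. Writing \<open>A = a x + (1 - a)\<close> and \<open>B = b x + (1 - b)\<close>,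
  the binomial theorem shows that this average maps the family \<open>A ^ (n - r) * B ^ (r - 1) * x\<close>
  to the same family with \<open>B\<close> (for \<open>l = 1\<close>) or \<open>A\<close> (for \<open>l = 2\<close>) replaced by
  \<open>(A + B) / 2\<close>: the dyadic interval \<open>[a, b]\<close> is replaced by its left or right half. The
  recursion starts from the interval \<open>[0, 1]\<close>, for which the family is \<open>x ^ r\<close>; this is not
  \<open>FL n r []\<close>, because \<open>pL n r [] j\<close> is the empty product \<open>1\<close> for all \<open>j\<close>.
\<close>

lemma smult_sum_right: "smult c (\<Sum>x\<in>S. f x) = (\<Sum>x\<in>S. smult c (f x))"
  by (induction S rule: infinite_finite_induct) (simp_all add: smult_add_right)

text \<open>Since \<open>b1 i r\<close> vanishes for \<open>r > i\<close>, every remaining term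
  contains \<open>A ^ (n - i)\<close>. With \<open>q = r - 1\<close> the other factors form the
  binomial expansion of \<open>(A + B) ^ (i - 1)\<close>, and the weight
  \<open>1 / 2 ^ (i - 1)\<close> halves its base.\<close>

lemma sum_binomial_b1:
  fixes A B :: "real poly"
  assumes "1 \<le> i" and "i \<le> n"
  shows "(\<Sum>r = 1..n. smult (b1 i r) (A ^ (n - r) * B ^ (r - 1)))
       = A ^ (n - i) * (smult (1 / 2) (A + B)) ^ (i - 1)"
proof -
  have "(\<Sum>r = 1..n. smult (b1 i r) (A ^ (n - r) * B ^ (r - 1)))
      = (\<Sum>r = 1..i. smult (b1 i r) (A ^ (n - r) * B ^ (r - 1)))"
    using assms by (intro sum.mono_neutral_right) (auto simp: b1_def binom_def)
  also have "\<dots> = (\<Sum>q\<le>i - 1. smult ((1 / 2) ^ (i - 1))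
                     (A ^ (n - i) * (of_nat (i - 1 choose q) * B ^ q * A ^ (i - 1 - q))))"
  proof (rule sum.reindex_bij_witness[of _ Suc "\<lambda>r. r - 1"], goal_cases)
    case (5 r)
    then have "A ^ (n - r) = A ^ (n - i) * A ^ (i - 1 - (r - 1))"
      using assms by (simp flip: power_add)
    moreover have "b1 i r = (1 / 2) ^ (i - 1) * real (i - 1 choose (r - 1))"
      using 5 by (auto simp: b1_def binom_def power_one_over nat_diff_distrib)
    ultimately show ?case
      by (simp add: of_nat_poly mult_ac)
  qed (use assms in auto)
  also have "\<dots> = A ^ (n - i) * (smult (1 / 2) (A + B)) ^ (i - 1)"
    by (simp add: smult_power add.commute[of A B] binomial_ring sum_distrib_left
                  smult_sum_right mult_ac)
  finally show ?thesis .
qed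

text \<open>Mirror image of \<open>sum_binomial_b1\<close>: for \<open>r < i\<close> the lower
  argument of \<open>binom\<close> is negative, so the common factor is now
  \<open>B ^ (i - 1)\<close>, and \<open>q = r - i\<close>.\<close>

lemma sum_binomial_b2:
  fixes A B :: "real poly"
  assumes "1 \<le> i" and "i \<le> n"
  shows "(\<Sum>r = 1..n. smult (b2 n i r) (A ^ (n - r) * B ^ (r - 1)))
       = (smult (1 / 2) (A + B)) ^ (n - i) * B ^ (i - 1)"
proof -
  have "(\<Sum>r = 1..n. smult (b2 n i r) (A ^ (n - r) * B ^ (r - 1)))
      = (\<Sum>r = i..n. smult (b2 n i r) (A ^ (n - r) * B ^ (r - 1)))"
    using assms by (intro sum.mono_neutral_right) (auto simp: b2_def binom_def)
  also have "\<dots> = (\<Sum>q\<le>n - i. smult ((1 / 2) ^ (n - i))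
                     (B ^ (i - 1) * (of_nat (n - i choose q) * B ^ q * A ^ (n - i - q))))"
  proof (rule sum.reindex_bij_witness[of _ "\<lambda>q. q + i" "\<lambda>r. r - i"], goal_cases)
    case (5 r)
    then have "B ^ (r - 1) = B ^ (i - 1) * B ^ (r - i)"
      using assms by (simp flip: power_add)
    moreover have "b2 n i r = (1 / 2) ^ (n - i) * real (n - i choose (r - i))"
      using 5 by (auto simp: b2_def binom_def power_one_over nat_diff_distrib)
    ultimately show ?case
      using 5 by (simp add: of_nat_poly mult_ac)
  qed (use assms in auto)
  also have "\<dots> = (smult (1 / 2) (A + B)) ^ (n - i) * B ^ (i - 1)"
    by (simp add: smult_power add.commute[of A B] binomial_ring sum_distrib_left
                  smult_sum_right mult_ac)
  finally show ?thesis .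
qed

lemma sum_bmat_g:
  assumes "1 \<le> i" and "i \<le> n"
  shows "(\<Sum>r = 1..n. smult (bmat n l i r) (g n r a b))
       = (if l = 1 then g n i a ((a + b) / 2) else g n i ((a + b) / 2) b)"
proof -
  let ?A = "[:1 - a, a:]" and ?B = "[:1 - b, b:]"
  \<comment> \<open>The coefficients are affine in the parameter, so averaging the polynomials
    averages the parameters.\<close>
  have mid: "smult (1 / 2) (?A + ?B) = [:1 - (a + b) / 2, (a + b) / 2:]"
    by (simp add: field_simps)
  have sum_g: "(\<Sum>r = 1..n. smult (c r) (g n r a b))
      = (\<Sum>r = 1..n. smult (c r) (?A ^ (n - r) * ?B ^ (r - 1))) * [:0, 1:]" for c
    unfolding g_def by (simp only: sum_distrib_right mult_smult_left)
  have "(\<Sum>r = 1..n. smult (b1 i r) (g n r a b)) = g n i a ((a + b) / 2)"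
    unfolding sum_g sum_binomial_b1[OF assms] mid by (rule g_def[symmetric])
  moreover have "(\<Sum>r = 1..n. smult (b2 n i r) (g n r a b)) = g n i ((a + b) / 2) b"
    unfolding sum_g sum_binomial_b2[OF assms] mid by (rule g_def[symmetric])
  ultimately show ?thesis
    by (simp add: bmat_def)
qed

lemma g_0_1:
  assumes "1 \<le> r"
  shows "g n r 0 1 = monom 1 r"
proof -
  have "[:0, 1:] = (monom 1 1 :: real poly)"
    by (simp add: monom_altdef)
  with assms show ?thesis
    by (simp add: g_def one_pCons[symmetric] monom_power mult_monom)
qed

lemma pL_singleton: "pL n i [l] j = bmat n l i j"
  by (simp add: pL_def path_def)

text \<open>The sum over paths is split by the value \<open>r\<close> of the first intermediate
  point; what follows, shifted down by one, is a path for \<open>L\<close> starting at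
  \<open>r\<close>.\<close>

lemma pL_Cons:
  assumes "L \<noteq> []"
  shows "pL n i (l # L) j = (\<Sum>r = 1..n. bmat n l i r * pL n r L j)"
proof -
  define k where "k = length L"
  have k: "k \<ge> 1"
    using assms by (cases L) (auto simp: k_def)
  define h where "h r s = (\<Prod>m = 1..k. bmat n (L ! (m - 1)) (path k r j s (m - 1)) (path k r j s m))"
    for r s
  define tail where "tail s = restrict (\<lambda>m. s (Suc m)) {1..k - 1}" for s :: "nat \<Rightarrow> nat"
  \<comment> \<open>At \<open>m = 0\<close> this uses \<open>k \<ge> 1\<close>: position
    \<open>1\<close> of the long path is then \<open>s 1\<close> and not yet the endpoint
    \<open>j\<close>.\<close>
  have path_tail: "path (Suc k) i j s (Suc m) = path k (s 1) j (tail s) m" if "m \<le> k" for s m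
    using that k by (auto simp: path_def tail_def)
  have "pL n i (l # L) j
      = (\<Sum>s \<in> {1..k} \<rightarrow>\<^sub>E {1..n}. bmat n l i (s 1) * h (s 1) (tail s))"
  proof -
    have "(\<Prod>m = 1..Suc k. bmat n ((l # L) ! (m - 1)) (path (Suc k) i j s (m - 1))
                             (path (Suc k) i j s m))
        = bmat n l i (s 1) * h (s 1) (tail s)" for s
    proof -
      have "(\<Prod>m = 1..Suc k. bmat n ((l # L) ! (m - 1)) (path (Suc k) i j s (m - 1))
                               (path (Suc k) i j s m))
          = bmat n l i (s 1) * (\<Prod>m = 1..k. bmat n ((l # L) ! m) (path (Suc k) i j s m)
                               (path (Suc k) i j s (Suc m)))"
        using k by (simp add: prod.atLeast_Suc_atMost prod.shift_bounds_cl_Suc_ivl path_def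
                         del: prod.cl_ivl_Suc)
      also have "(\<Prod>m = 1..k. bmat n ((l # L) ! m) (path (Suc k) i j s m)
                               (path (Suc k) i j s (Suc m))) = h (s 1) (tail s)"
        unfolding h_def
      proof (rule prod.cong[OF refl])
        fix m assume m: "m \<in> {1..k}"
        then show "bmat n ((l # L) ! m) (path (Suc k) i j s m) (path (Suc k) i j s (Suc m))
            = bmat n (L ! (m - 1)) (path k (s 1) j (tail s) (m - 1)) (path k (s 1) j (tail s) m)"
          using path_tail[of "m - 1" s] path_tail[of m s] by (auto simp: nth_Cons')
      qed
      finally show ?thesis .
    qed
    then show ?thesis
      by (simp add: pL_def k_def)
  qed
  also have "\<dots> = (\<Sum>(r, s) \<in> {1..n} \<times> ({1..k - 1} \<rightarrow>\<^sub>E {1..n}). bmat n l i r * h r s)"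
  \<comment> \<open>The inverse prepends \<open>r\<close> to \<open>s\<close>; the restrictions on
    both sides keep the maps extensional.\<close>
  proof (rule sum.reindex_bij_witness[of _
            "\<lambda>(r, s). restrict (\<lambda>m. if m = 1 then r else s (m - 1)) {1..k}"
            "\<lambda>s. (s 1, tail s)"], goal_cases)
    case (1 s)
    then show ?case
      by (auto simp: tail_def fun_eq_iff PiE_def extensional_def)
  next
    case (2 s)
    with k have "s 1 \<in> {1..n}" by (intro PiE_mem[OF 2]) auto
    moreover have "tail s \<in> {1..k - 1} \<rightarrow>\<^sub>E {1..n}"
      unfolding tail_def
    proof (rule restrict_PiE_iff[THEN iffD2], rule ballI)
      fix m assume "m \<in> {1..k - 1}"
      then show "s (Suc m) \<in> {1..n}" by (intro PiE_mem[OF 2]) auto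
    qed
    ultimately show ?case by simp
  next
    case (3 x)
    then show ?case
      using k by (auto simp: tail_def fun_eq_iff PiE_def extensional_def)
  next
    case (4 x)
    obtain r s where x: "x = (r, s)" by (cases x)
    have "s (m - 1) \<in> {1..n}" if "m \<in> {1..k}" "m \<noteq> 1" for m
      using 4 that unfolding x by (intro PiE_mem[of s "{1..k - 1}"]) auto
    then show ?case
      using 4 unfolding x by (auto simp: restrict_PiE_iff)
  qed auto
  also have "\<dots> = (\<Sum>r = 1..n. bmat n l i r * pL n r L j)"
    by (simp add: sum.cartesian_product[symmetric] sum_distrib_left pL_def h_def k_def)
  finally show ?thesis .
qed

text \<open>The summation index of \<open>FL\<close> becomes the averaged start, because
  \<open>x ^ r\<close> is \<open>g n r 0 1\<close>.\<close>

lemma FL_singleton: "FL n i [l] = (\<Sum>r = 1..n. smult (bmat n l i r) (g n r 0 1))"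
  by (simp add: FL_def pL_singleton g_0_1 smult_monom)

lemma FL_Cons:
  assumes "L \<noteq> []"
  shows "FL n i (l # L) = (\<Sum>r = 1..n. smult (bmat n l i r) (FL n r L))"
proof -
  have "FL n i (l # L) = (\<Sum>j = 1..n. \<Sum>r = 1..n. monom (bmat n l i r * pL n r L j) j)"
    by (simp add: FL_def pL_Cons[OF assms] monom_sum)
  also have "\<dots> = (\<Sum>r = 1..n. \<Sum>j = 1..n. monom (bmat n l i r * pL n r L j) j)"
    by (rule sum.swap)
  finally show ?thesis
    by (simp add: FL_def smult_sum_right smult_monom)
qed

text \<open>Induction on the length, from one-entry lists upwards. The start \<open>i\<close> stays
  arbitrary because \<open>FL_Cons\<close> needs the hypothesis at every \<open>r\<close>.\<close>

lemma FL_has_index: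
  assumes "1 \<le> i" and "i \<le> n" and "has_index (Suc k) L t"
  shows "FL n i L = g n i ((real t - 1) / 2 ^ Suc k) (real t / 2 ^ Suc k)"
  using assms
proof (induction k arbitrary: i L t)
  case 0
  then obtain l where L: "L = [l]" and l: "l \<in> {1, 2}" and t: "t = l"
    by (auto simp: has_index_def length_Suc_conv)
  show ?case
    using 0 l unfolding L t FL_singleton by (subst sum_bmat_g) auto
next
  case (Suc k)
  then obtain l M where L: "L = l # M"
    by (cases L) (auto simp: has_index_def)
  with Suc.prems obtain u where l: "l \<in> {1, 2}" and M: "has_index (Suc k) M u"
    and tu: "t + 2 = 2 * u + l"
    by (auto simp: has_index_Cons)
  have t: "real t = 2 * real u + real l - 2"
    using tu by linarith
  \<comment> \<open>On the finer grid the interval of \<open>M\<close> runs from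
    \<open>2 * u - 2\<close> to \<open>2 * u\<close>. Its midpoint \<open>2 * u - 1\<close> equals
    \<open>t\<close> if \<open>l = 1\<close> and \<open>t - 1\<close> if
    \<open>l = 2\<close>.\<close>
  have halves: "(real u - 1) / 2 ^ Suc k = (2 * real u - 2) / 2 ^ Suc (Suc k)"
    "real u / 2 ^ Suc k = 2 * real u / 2 ^ Suc (Suc k)"
    "((2 * real u - 2) / 2 ^ Suc (Suc k) + 2 * real u / 2 ^ Suc (Suc k)) / 2
      = (2 * real u - 1) / 2 ^ Suc (Suc k)"
    by (simp_all add: field_simps)
  have "M \<noteq> []"
    using M by (auto simp: has_index_def)
  then have "FL n i L
      = (\<Sum>r = 1..n. smult (bmat n l i r) (g n r ((real u - 1) / 2 ^ Suc k) (real u / 2 ^ Suc k)))"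
    unfolding L by (simp add: FL_Cons Suc.IH[OF _ _ M])
  also have "\<dots> = g n i ((real t - 1) / 2 ^ Suc (Suc k)) (real t / 2 ^ Suc (Suc k))"
    using l t by (subst sum_bmat_g[OF Suc.prems(1,2)]) (auto simp: halves simp del: power_Suc)
  finally show ?case .
qed

theorem theorem2:
  fixes n i k t :: nat
  assumes "n \<ge> 1" and "1 \<le> i" and "i \<le> n" and "k \<ge> 1" and "t \<in> {1..2 ^ k}"
  shows "FL n i (list_of_index k t) = g n i ((real t - 1) / 2 ^ k) (real t / 2 ^ k)"
proof -
  have "has_index k (list_of_index k t) t"
    unfolding list_of_index_def by (rule theI'[OF has_index_ex1[OF assms(5)]])
  with assms show ?thesis
    by (cases k) (auto simp: FL_has_index simp del: power_Suc)
qed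

end
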